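(* Let $X$ be a $T_0$ topological space. Let $f, p : X \to \Omega(X)$ be the maps defined, for each $x \in X$, by $$f(x) = \bigcup\{U \in \Omega(X) \mid \exists V \in \mathcal{N}_x,\ U \cap V = \emptyset\}, \qquad p(x) = X \setminus \overline{\{x\}}.$$ Then $X$ is Hausdorff if and only if $f = p$.
   Context: For a topological space $X$, $\Omega(X)$ denotes its locale (frame) of open sets, ordered by inclusion. For $x \in X$, $\mathcal{N}_x \subseteq \Omega(X)$ denotes the set of all open neighborhoods of $x$, and $\overline{\{x\}}$ is the closure of $\{x\}$. Thus $f(x)=\phi(\mathcal{N}_x)$, where for $\mathcal{U}\subseteq \Omega(X)$ open in the Scott topology of $\Omega(X)$ one puts $\phi(\mathcal{U}) = \bigcup\{U \in \Omega(X) \mid \exists V \in \mathcal{U},\ U \cap V = \emptyset\}$ (the set $\mathcal{N}_x$ is Scott open). *)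

theory Defs
  imports "HOL-Analysis.Analysis"
begin

definition open_nhds :: "'a topology \<Rightarrow> 'a \<Rightarrow> 'a set set" where
  "open_nhds X x = {V. openin X V \<and> x \<in> V}"

definition f_map :: "'a topology \<Rightarrow> 'a \<Rightarrow> 'a set" where
  "f_map X x = \<Union>{U. openin X U \<and> (\<exists>V\<in>open_nhds X x. U \<inter> V = {})}"

definition p_map :: "'a topology \<Rightarrow> 'a \<Rightarrow> 'a set" where
  "p_map X x = topspace X - X closure_of {x}"

text \<open>Both maps take values in the frame of open sets. They are total functions on the carrier
  type; only their values at points of \<^term>\<open>topspace X\<close> are meaningful.\<close>

lemma openin_f_map: "openin X (f_map X x)"
  unfolding f_map_def by (rule openin_Union) blast

lemma openin_p_map: "openin X (p_map X x)"
  unfolding p_map_def by (simp add: openin_diff)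

end

(* A point y lies in f x iff x and y have disjoint open neighbourhoods, and in p x iff y has an
   open neighbourhood missing x. T0 provides the latter for one of the two orderings of any pair
   of distinct points, so f = p upgrades T0 separation to Hausdorff separation. *)
theory Submission
  imports Defs
begin

lemma in_f_map_iff:
  "y \<in> f_map X x \<longleftrightarrow> (\<exists>U V. openin X U \<and> openin X V \<and> y \<in> U \<and> x \<in> V \<and> disjnt U V)"
  unfolding f_map_def open_nhds_def disjnt_def by blast

text \<open>The complement of the closure of \<open>{x}\<close> is the largest open set missing
  \<open>x\<close>.\<close>

lemma in_p_map_iff:
  "y \<in> p_map X x \<longleftrightarrow> (\<exists>U. openin X U \<and> y \<in> U \<and> x \<notin> U)"
  unfolding p_map_def using openin_subset by (fastforce simp: in_closure_of)

text \<open>A set disjoint from a neighbourhood of \<open>x\<close> misses \<open>x\<close>. Hence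
  only the reverse inclusion depends on separation.\<close>

lemma f_map_subset_p_map: "f_map X x \<subseteq> p_map X x"
  unfolding subset_iff in_f_map_iff in_p_map_iff disjnt_iff by blast

theorem corollary3p4:
  fixes X :: "'a topology"
  assumes "t0_space X"
  shows "Hausdorff_space X \<longleftrightarrow> (\<forall>x\<in>topspace X. f_map X x = p_map X x)"
proof
  assume H: "Hausdorff_space X"
  show "\<forall>x\<in>topspace X. f_map X x = p_map X x"
  proof (intro ballI equalityI f_map_subset_p_map subsetI)
    fix x y assume x: "x \<in> topspace X" and "y \<in> p_map X x"
    then have "y \<in> topspace X" "y \<noteq> x"
      unfolding in_p_map_iff using openin_subset by blast+
    with H x show "y \<in> f_map X x"
      unfolding Hausdorff_space_def in_f_map_iff by blast
  qed
next
  assume eq: "\<forall>x\<in>topspace X. f_map X x = p_map X x"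
  show "Hausdorff_space X"
    unfolding Hausdorff_space_def
  proof (intro allI impI)
    fix x y assume xy: "x \<in> topspace X \<and> y \<in> topspace X \<and> x \<noteq> y"
    with assms obtain U where "openin X U" "x \<notin> U \<longleftrightarrow> y \<in> U"
      unfolding t0_space_def by blast
    \<comment> \<open>T0 does not tell which of the two points lies in \<open>U\<close>, hence the
      disjunction.\<close>
    then have "y \<in> p_map X x \<or> x \<in> p_map X y"
      unfolding in_p_map_iff by blast
    with eq xy have "y \<in> f_map X x \<or> x \<in> f_map X y"
      by blast
    \<comment> \<open>Having disjoint neighbourhoods is symmetric in \<open>x\<close> and
      \<open>y\<close>, so both cases give the same conclusion.\<close>
    then show "\<exists>U V. openin X U \<and> openin X V \<and> x \<in> U \<and> y \<in> V \<and> disjnt U V"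
      unfolding in_f_map_iff using disjnt_sym by blast
  qed
qed

end
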